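(* Let $X$ be a dyadic compactum with a base $\mathcal{A}$ consisting only of cozero sets. If $Nt(X)\leq\omega_1$, then $\mathcal{A}$ contains a subset that is an $\omega^{\mathrm{op}}$-like base of $X$. Hence, no dyadic compactum has Noetherian type $\omega_1$.
   Context: A dyadic compactum is a Hausdorff continuous image of $2^\kappa$ for some cardinal $\kappa$. A cozero set is a set of the form $X\setminus f^{-1}\{0\}$ for continuous $f\colon X\to\mathbb{R}$. Families of open sets are ordered by inclusion; a family is $\mu^{\mathrm{op}}$-like if no member is contained in $\mu$-many members. $Nt(X)$ (Noetherian type) is the least $\mu\geq\omega$ such that $X$ has a $\mu^{\mathrm{op}}$-like base. *)

theory Defs
  imports "HOL-Analysis.Analysis"
begin

unbundle cardinal_syntax

text \<open>Dyadic compactum: a Hausdorff space that is a continuous image of the Cantor cube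
  2^I, where the index set I lives in the type 'i (the theorem quantifies over all types 'i,
  hence over all cardinals kappa).\<close>
definition dyadic_compactum :: "'i itself \<Rightarrow> 'a topology \<Rightarrow> bool" where
  "dyadic_compactum _ X \<longleftrightarrow> Hausdorff_space X \<and>
     (\<exists>(I::'i set) f. continuous_map (product_topology (\<lambda>_. discrete_topology {0::nat,1}) I) X f
        \<and> f ` topspace (product_topology (\<lambda>_. discrete_topology {0::nat,1}) I) = topspace X)"

definition cozero_set :: "'a topology \<Rightarrow> 'a set \<Rightarrow> bool" where
  "cozero_set X U \<longleftrightarrow> (\<exists>f. continuous_map X euclideanreal f \<and> U = topspace X - {x \<in> topspace X. f x = 0})"

definition is_base :: "'a topology \<Rightarrow> 'a set set \<Rightarrow> bool" where
  "is_base X B \<longleftrightarrow> (\<forall>U\<in>B. openin X U) \<and>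
     (\<forall>U. openin X U \<longrightarrow> (\<forall>x\<in>U. \<exists>V\<in>B. x \<in> V \<and> V \<subseteq> U))"

definition op_like :: "'b rel \<Rightarrow> 'a set set \<Rightarrow> bool" where
  "op_like \<mu> B \<longleftrightarrow> (\<forall>A\<in>B. |{C \<in> B. A \<subseteq> C}| <o \<mu>)"

text \<open>Nt(X) \<le> mu: the least infinite cardinal nu admitting a nu^op-like base is \<le> mu,
  i.e. some infinite cardinal nu \<le> mu admits a nu^op-like base.\<close>
definition Nt_le :: "'a topology \<Rightarrow> 'b rel \<Rightarrow> bool" where
  "Nt_le X \<mu> \<longleftrightarrow> (\<exists>\<nu>::'b rel. Card_order \<nu> \<and> natLeq \<le>o \<nu> \<and> \<nu> \<le>o \<mu> \<and>
      (\<exists>B. is_base X B \<and> op_like \<nu> B))"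

definition Nt_lt :: "'a topology \<Rightarrow> 'b rel \<Rightarrow> bool" where
  "Nt_lt X \<mu> \<longleftrightarrow> (\<exists>\<nu>::'b rel. Card_order \<nu> \<and> natLeq \<le>o \<nu> \<and> \<nu> <o \<mu> \<and>
      (\<exists>B. is_base X B \<and> op_like \<nu> B))"

definition Nt_eq :: "'a topology \<Rightarrow> 'b rel \<Rightarrow> bool" where
  "Nt_eq X \<mu> \<longleftrightarrow> Nt_le X \<mu> \<and> \<not> Nt_lt X \<mu>"

abbreviation omega1 :: "nat set rel" where
  "omega1 \<equiv> cardSuc natLeq"

end

(*
Fix a continuous surjection f from a Cantor cube onto X and an omega1^op-like base Q, and call a
subfamily N of A closed if it is closed under a suitable map Phi from finite subfamilies to
countable subfamilies.  Closedness gives two reflection properties.  Since a nonempty open set has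
only countably many supersets in Q, a closed N containing a local pi-base at a point contains a
local base there.  Since preimages of cozero sets depend on countably many coordinates, for every
nonempty open U there is a member of N that is contained in all supersets of U in N.

A base of X is then built along A.  If D is a finite union of closed families, B is a subfamily
of D that is already omega^op-like and a base for the members of D, and M is a countable closed
family, then B is extended to D \<union> M by sets that contain no member of D: at a point q, either
some closed part of D has a local base at q, and nothing new is needed, or small neighbourhoods of
q contain no member of D.  Old sets get no new supersets, and a new set has only finitely many
supersets in B because each of the finitely many closed parts of D reflects them to a single
member.  Larger families M are reached by induction on their cardinality along a continuous chain
of smaller closed families N, which keeps each D \<union> N a finite union of closed families.
*)
theory Submission
  imports Defs
begin

section \<open>Families closed under finitary operations\<close>

text \<open>The choice \<open>F = {}\<close> is included, so a closed family contains
  \<open>\<Phi> {}\<close>. This is how a member can be found in \<open>N\<close> even when nothing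
  is known to lie in it.\<close>

definition closed_under :: "('b set \<Rightarrow> 'b set) \<Rightarrow> 'b set \<Rightarrow> bool" where
  "closed_under \<Phi> N \<longleftrightarrow> (\<forall>F. finite F \<longrightarrow> F \<subseteq> N \<longrightarrow> \<Phi> F \<subseteq> N)"

lemma closed_underD: "closed_under \<Phi> N \<Longrightarrow> finite F \<Longrightarrow> F \<subseteq> N \<Longrightarrow> \<Phi> F \<subseteq> N"
  by (simp add: closed_under_def)

lemma closed_under_Un_iff:
  "closed_under (\<lambda>F. \<Phi> F \<union> \<Psi> F) N \<longleftrightarrow> closed_under \<Phi> N \<and> closed_under \<Psi> N"
  by (auto simp: closed_under_def)

text \<open>A finite subset of the union of a nonempty chain already lies in one member of the
  chain.\<close>

lemma closed_under_Union_chain: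
  assumes "\<And>N. N \<in> \<C> \<Longrightarrow> closed_under \<Phi> N" "\<C> \<noteq> {}"
    and "\<And>M N. M \<in> \<C> \<Longrightarrow> N \<in> \<C> \<Longrightarrow> M \<subseteq> N \<or> N \<subseteq> M"
  shows "closed_under \<Phi> (\<Union>\<C>)"
  unfolding closed_under_def
proof (intro allI impI)
  fix F assume F: "finite F" "F \<subseteq> \<Union>\<C>"
  have "subset.chain UNIV \<C>"
    using assms(3) by (auto simp: subset_chain_def)
  then obtain N where "N \<in> \<C>" "F \<subseteq> N"
    using finite_subset_Union_chain[OF F assms(2)] by metis
  then show "\<Phi> F \<subseteq> \<Union>\<C>"
    using assms(1) F(1) closed_underD by blast
qed

text \<open>Iterate the operation countably often from \<open>S\<close>. A finite subset of the
  increasing union lies in one stage, so its value is added at the next.\<close>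

lemma countable_closure:
  assumes "countable S" "S \<subseteq> A"
    and \<Phi>: "\<And>F. finite F \<Longrightarrow> F \<subseteq> A \<Longrightarrow> countable (\<Phi> F) \<and> \<Phi> F \<subseteq> A"
  obtains M where "S \<subseteq> M" "M \<subseteq> A" "countable M" "closed_under \<Phi> M"
proof -
  define step where "step T = T \<union> (\<Union>F\<in>{F. finite F \<and> F \<subseteq> T}. \<Phi> F)" for T
  define T where "T n = (step ^^ n) S" for n
  have TSuc: "T (Suc n) = step (T n)" for n by (simp add: T_def)
  have T: "countable (T n) \<and> T n \<subseteq> A" for n
  proof (induction n)
    case 0 then show ?case using assms by (simp add: T_def)
  next
    case (Suc n)
    then have "countable (\<Phi> F) \<and> \<Phi> F \<subseteq> A" if "finite F" "F \<subseteq> T n" for F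
      using \<Phi>[OF that(1)] that(2) by (meson subset_trans)
    with Suc show ?case
      unfolding TSuc step_def by (auto intro!: countable_UN countable_Collect_finite_subset)
  qed
  have "T n \<subseteq> T (Suc n)" for n by (simp add: TSuc step_def)
  then have mono: "mono T" by (simp add: mono_iff_le_Suc)
  have "closed_under \<Phi> (\<Union>n. T n)"
    unfolding closed_under_def
  proof (intro allI impI)
    fix F assume F: "finite F" "F \<subseteq> (\<Union>n. T n)"
    have "\<exists>n. F \<subseteq> T n"
      using F
    proof (induction F)
      case (insert x F)
      then obtain m n where "F \<subseteq> T m" "x \<in> T n" by auto
      then have "insert x F \<subseteq> T (max m n)"
        using monoD[OF mono, of m "max m n"] monoD[OF mono, of n "max m n"] by auto
      then show ?case by blast
    qed simp
    then obtain n where "F \<subseteq> T n" ..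
    then have "\<Phi> F \<subseteq> T (Suc n)" using F(1) by (auto simp: TSuc step_def)
    then show "\<Phi> F \<subseteq> (\<Union>n. T n)" by blast
  qed
  moreover have "S \<subseteq> (\<Union>n. T n)" using UN_upper[of 0 UNIV T] by (simp add: T_def)
  ultimately show thesis using that T by (metis UN_least countableI_type countable_UN)
qed

section \<open>Bases with the two reflection properties\<close>

locale reflecting_base =
  fixes X :: "'a topology" and A :: "'a set set" and \<Phi> :: "'a set set \<Rightarrow> 'a set set"
  assumes compact: "compact_space X" and Hausdorff: "Hausdorff_space X"
    and base: "is_base X A" and nonempty: "{} \<notin> A"
    \<comment> \<open>Each \<open>K n\<close> can be covered by finitely many finer sets, so
      countably many finite covers refine \<open>U\<close>.\<close>
    and sigma_compact: "U \<in> A \<Longrightarrow> \<exists>K::nat \<Rightarrow> 'a set. (\<forall>n. compactin X (K n)) \<and> U = (\<Union>n. K n)"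
    and \<Phi>: "finite F \<Longrightarrow> F \<subseteq> A \<Longrightarrow> countable (\<Phi> F) \<and> \<Phi> F \<subseteq> A"
    and local_base_reflects: "N \<subseteq> A \<Longrightarrow> closed_under \<Phi> N \<Longrightarrow>
        (\<And>P. openin X P \<Longrightarrow> q \<in> P \<Longrightarrow> \<exists>V\<in>N. V \<subseteq> P) \<Longrightarrow>
        openin X P \<Longrightarrow> q \<in> P \<Longrightarrow> \<exists>V\<in>N. q \<in> V \<and> V \<subseteq> P"
    \<comment> \<open>\<open>U\<close> may lie outside \<open>N\<close>, and one \<open>U'\<close>
      serves all \<open>W\<close> at once. Hence finiteness of the set of supersets passes from
      members of \<open>N\<close> to all of \<open>A\<close>.\<close>
    and supersets_reflect: "N \<subseteq> A \<Longrightarrow> closed_under \<Phi> N \<Longrightarrow> U \<in> A \<Longrightarrow>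
        \<exists>U'\<in>N. \<forall>W\<in>N. U \<subseteq> W \<longrightarrow> U' \<subseteq> W"
begin

lemma A_open: "U \<in> A \<Longrightarrow> openin X U"
  using base by (simp add: is_base_def)

lemma A_nhd: "openin X P \<Longrightarrow> q \<in> P \<Longrightarrow> \<exists>U\<in>A. q \<in> U \<and> U \<subseteq> P"
  using base by (simp add: is_base_def)

text \<open>A union of two closed families need not be closed, since a finite \<open>F\<close> may
  take members from both. The reflection properties are therefore applied to each of the finitely
  many pieces.\<close>

definition finitely_closed :: "'a set set \<Rightarrow> bool" where
  "finitely_closed D \<longleftrightarrow> (\<exists>\<N>. finite \<N> \<and> (\<forall>N\<in>\<N>. N \<subseteq> A \<and> closed_under \<Phi> N) \<and> D = \<Union>\<N>)"

text \<open>Finiteness is required at every \<open>U\<close> in \<open>D\<close>, not just in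
  \<open>B\<close>, because the sets produced by \<open>supersets_reflect\<close> lie in
  \<open>D\<close> but perhaps not in \<open>B\<close>. For \<open>D = A\<close> this makes
  \<open>B\<close> an omega^op-like base of the space.\<close>

definition partial_base :: "'a set set \<Rightarrow> 'a set set \<Rightarrow> bool" where
  "partial_base D B \<longleftrightarrow> finitely_closed D \<and> B \<subseteq> D \<and> (\<forall>U\<in>D. finite {W\<in>B. U \<subseteq> W}) \<and>
     (\<forall>V\<in>D. \<forall>p\<in>V. \<exists>U\<in>B. p \<in> U \<and> U \<subseteq> V)"

text \<open>The point is that a member of \<open>D\<close> has the same supersets in
  \<open>B'\<close> as in \<open>B\<close>, so finiteness survives unions of chains of
  extensions.\<close>

definition end_extends :: "'a set set \<Rightarrow> 'a set set \<Rightarrow> 'a set set \<Rightarrow> bool" where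
  "end_extends D B B' \<longleftrightarrow> B \<subseteq> B' \<and> (\<forall>W\<in>B'-B. \<forall>V\<in>D. \<not> V \<subseteq> W)"

lemma end_extends_refl: "end_extends D B B"
  by (simp add: end_extends_def)

lemma end_extends_trans:
  "end_extends D B B' \<Longrightarrow> end_extends D' B' B'' \<Longrightarrow> D \<subseteq> D' \<Longrightarrow> end_extends D B B''"
  unfolding end_extends_def by (meson Diff_iff subset_iff)

lemma finitely_closed_subset: "finitely_closed D \<Longrightarrow> D \<subseteq> A"
  by (auto simp: finitely_closed_def)

lemma finitely_closed_Un:
  "finitely_closed D \<Longrightarrow> N \<subseteq> A \<Longrightarrow> closed_under \<Phi> N \<Longrightarrow> finitely_closed (D \<union> N)"
  unfolding finitely_closed_def
  by (metis Union_insert finite_insert insert_iff sup_commute)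

lemma partial_base_empty: "partial_base {} {}"
  unfolding partial_base_def finitely_closed_def by (auto intro: exI[of _ "{}"])

text \<open>The singleton alternative is needed at isolated points, which cannot avoid the member \<open>{q}\<close> of \<open>F\<close>.\<close>

lemma fine_nhd:
  assumes D: "finitely_closed D" and "U \<in> A" "finite F" "F \<subseteq> A" "q \<in> U"
  shows "\<exists>U'\<in>A. q \<in> U' \<and> U' \<subseteq> U \<and> (U' \<in> D \<or> (\<forall>V\<in>D. \<not> V \<subseteq> U')) \<and>
           ((\<exists>x. U' = {x}) \<or> (\<forall>V\<in>F. \<not> V \<subseteq> U'))"
proof (cases "openin X {q}")
  case True
  then have "{q} \<in> A" using A_nhd[of "{q}" q] by (metis empty_iff insertI1 subset_singletonD)
  \<comment> \<open>Hence \<open>{q}\<close> either belongs to \<open>D\<close> or contains no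
    member of \<open>D\<close>.\<close>
  moreover have "V = {q}" if "V \<in> D" "V \<subseteq> {q}" for V
    using that nonempty finitely_closed_subset[OF D] by (metis subset_iff subset_singletonD)
  ultimately show ?thesis using assms by (intro bexI[of _ "{q}"]) auto
next
  case False
  obtain \<N> where \<N>: "finite \<N>" "\<And>N. N \<in> \<N> \<Longrightarrow> N \<subseteq> A \<and> closed_under \<Phi> N" "D = \<Union>\<N>"
    using D by (auto simp: finitely_closed_def)
  \<comment> \<open>Deleting from \<open>U\<close> one point other than \<open>q\<close> of each
    member of \<open>F\<close> leaves a neighbourhood of \<open>q\<close> that contains no member of
    \<open>F\<close>. It is open because finite sets are closed in a Hausdorff space.\<close>
  have "\<exists>v\<in>V. v \<noteq> q" if "V \<in> F" for V
  proof -
    have "openin X V" "V \<noteq> {}" using A_open that assms nonempty by auto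
    then show ?thesis using False by (metis all_not_in_conv insert_absorb singleton_iff subsetI subset_antisym)
  qed
  then obtain v where v: "\<And>V. V \<in> F \<Longrightarrow> v V \<in> V \<and> v V \<noteq> q" by metis
  have U: "openin X U" using A_open assms by blast
  have "closedin X (v ` F \<inter> topspace X)"
    using Hausdorff \<open>finite F\<close> by (intro closedin_Hausdorff_finite) auto
  then have P: "openin X (U - v ` F)" (is "openin X ?P")
  proof -
    have "U - v ` F = U \<inter> (topspace X - v ` F \<inter> topspace X)" using openin_subset[OF U] by blast
    then show ?thesis
      using U \<open>closedin X (v ` F \<inter> topspace X)\<close> by (metis openin_Int openin_diff openin_topspace)
  qed
  have q: "q \<in> ?P" using v \<open>q \<in> U\<close> by auto
  have F: "\<not> V \<subseteq> U'" if "U' \<subseteq> ?P" "V \<in> F" for U' V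
    using v that by blast
  \<comment> \<open>If some piece \<open>N\<close> of \<open>D\<close> has a member inside every
    neighbourhood of \<open>q\<close>, reflection supplies \<open>U'\<close> from \<open>N\<close>
    itself. Otherwise each piece has a neighbourhood of \<open>q\<close> containing none of its
    members, and the finitely many neighbourhoods are intersected.\<close>
  show ?thesis
  proof (cases "\<exists>N\<in>\<N>. \<forall>P. openin X P \<longrightarrow> q \<in> P \<longrightarrow> (\<exists>V\<in>N. V \<subseteq> P)")
    case True
    then obtain N where N: "N \<in> \<N>" "\<And>P. openin X P \<Longrightarrow> q \<in> P \<Longrightarrow> (\<exists>V\<in>N. V \<subseteq> P)" by blast
    then obtain U' where "U' \<in> N" "q \<in> U'" "U' \<subseteq> ?P"
      using local_base_reflects[OF _ _ N(2) P q] \<N>(2)[OF N(1)] by metis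
    moreover have "U' \<in> A" "U' \<in> D" using \<N>(2)[OF N(1)] \<N>(3) N(1) \<open>U' \<in> N\<close> by auto
    ultimately show ?thesis using F by (intro bexI[of _ U']) auto
  next
    case False
    then obtain O' where O': "\<And>N. N \<in> \<N> \<Longrightarrow> openin X (O' N) \<and> q \<in> O' N \<and> (\<forall>V\<in>N. \<not> V \<subseteq> O' N)"
      by metis
    have "openin X (\<Inter>(insert ?P (O' ` \<N>)))"
      using O' P \<N>(1) by (intro openin_Inter) auto
    moreover have "q \<in> \<Inter>(insert ?P (O' ` \<N>))" using O' q by auto
    ultimately obtain U' where U': "U' \<in> A" "q \<in> U'" "U' \<subseteq> \<Inter>(insert ?P (O' ` \<N>))"
      using A_nhd by metis
    have "\<not> V \<subseteq> U'" if V: "V \<in> D" for V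
    proof -
      obtain N where N: "N \<in> \<N>" "V \<in> N" using V \<N>(3) by blast
      then have "\<not> V \<subseteq> O' N" using O' by blast
      moreover have "U' \<subseteq> O' N" using U'(3) N(1) by blast
      ultimately show ?thesis by blast
    qed
    then show ?thesis using U' F by (intro bexI[of _ U']) auto
  qed
qed

text \<open>Compactness selects finitely many of the neighbourhoods from \<open>fine_nhd\<close>;
  the finiteness of \<open>G\<close> is what makes supersets countable one cover at a time in
  \<open>extend_countable\<close>.\<close>

lemma fine_cover:
  assumes D: "finitely_closed D" and "U \<in> A" "finite F" "F \<subseteq> A" "compactin X K" "K \<subseteq> U"
  shows "\<exists>G. finite G \<and> G \<subseteq> A \<and> K \<subseteq> \<Union>G \<and> (\<forall>U'\<in>G. U' \<subseteq> U \<and> (U' \<in> D \<or> (\<forall>V\<in>D. \<not> V \<subseteq> U')) \<and>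
           ((\<exists>x. U' = {x}) \<or> (\<forall>V\<in>F. \<not> V \<subseteq> U')))"
proof -
  let ?\<U> = "{U'\<in>A. U' \<subseteq> U \<and> (U' \<in> D \<or> (\<forall>V\<in>D. \<not> V \<subseteq> U')) \<and> ((\<exists>x. U' = {x}) \<or> (\<forall>V\<in>F. \<not> V \<subseteq> U'))}"
  have "K \<subseteq> \<Union>?\<U>"
  proof
    fix q assume "q \<in> K"
    then have "\<exists>U'. U' \<in> ?\<U> \<and> q \<in> U'" using fine_nhd[OF assms(1-4), of q] assms(6)
      by (simp add: Bex_def subset_iff) (metis (no_types, lifting))
    then show "q \<in> \<Union>?\<U>" by (simp add: Union_iff Bex_def)
  qed
  moreover have "Ball ?\<U> (openin X)" using A_open by auto
  ultimately obtain G where "finite G" "G \<subseteq> ?\<U>" "K \<subseteq> \<Union>G"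
    using assms(5) unfolding compactin_def by meson
  then have "G \<subseteq> A" "\<forall>U'\<in>G. U' \<subseteq> U \<and> (U' \<in> D \<or> (\<forall>V\<in>D. \<not> V \<subseteq> U')) \<and>
           ((\<exists>x. U' = {x}) \<or> (\<forall>V\<in>F. \<not> V \<subseteq> U'))"
    by (simp_all add: subset_iff)
  then show ?thesis using \<open>finite G\<close> \<open>K \<subseteq> \<Union>G\<close> by metis
qed

section \<open>Adding a countable closed family\<close>

text \<open>\<open>M\<close> is closed not only under \<open>\<Phi>\<close> but also under the
  choice of fine covers of its members. The new sets are taken from these covers, and an enumeration
  of \<open>M\<close> decides which sets each cover has to avoid.\<close>

lemma extend_countable:
  assumes DB: "partial_base D B" and S: "countable S" "S \<subseteq> A"
  obtains M B' where "S \<subseteq> M" "M \<subseteq> A" "countable M" "closed_under \<Phi> M"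
    "partial_base (D \<union> M) B'" "end_extends D B B'"
proof -
  have D: "finitely_closed D" using DB by (simp add: partial_base_def)
  obtain K :: "'a set \<Rightarrow> nat \<Rightarrow> 'a set"
    where K: "\<And>U n. U \<in> A \<Longrightarrow> compactin X (K U n)" "\<And>U. U \<in> A \<Longrightarrow> U = (\<Union>n. K U n)"
    using sigma_compact by metis
  have "\<forall>U n F. \<exists>G. U \<in> A \<longrightarrow> finite F \<longrightarrow> F \<subseteq> A \<longrightarrow>
      finite G \<and> G \<subseteq> A \<and> K U n \<subseteq> \<Union>G \<and> (\<forall>U'\<in>G. U' \<subseteq> U \<and> (U' \<in> D \<or> (\<forall>V\<in>D. \<not> V \<subseteq> U')) \<and>
           ((\<exists>x. U' = {x}) \<or> (\<forall>V\<in>F. \<not> V \<subseteq> U')))"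
    (is "\<forall>U n F. ?P U n F")
  proof (intro allI)
    fix U n F
    have "K U n \<subseteq> U" if "U \<in> A" using K(2)[OF that] by blast
    then show "?P U n F"
      using fine_cover[OF D _ _ _ K(1)] by simp
  qed
  then obtain G where "\<forall>U n F. U \<in> A \<longrightarrow> finite F \<longrightarrow> F \<subseteq> A \<longrightarrow>
      finite (G U n F) \<and> G U n F \<subseteq> A \<and> K U n \<subseteq> \<Union>(G U n F) \<and>
      (\<forall>U'\<in>G U n F. U' \<subseteq> U \<and> (U' \<in> D \<or> (\<forall>V\<in>D. \<not> V \<subseteq> U')) \<and>
           ((\<exists>x. U' = {x}) \<or> (\<forall>V\<in>F. \<not> V \<subseteq> U')))"
    by metis
  then have G: "finite (G U n F)" "G U n F \<subseteq> A" "K U n \<subseteq> \<Union>(G U n F)"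
      "\<And>U'. U' \<in> G U n F \<Longrightarrow> U' \<subseteq> U"
      "\<And>U'. U' \<in> G U n F \<Longrightarrow> U' \<in> D \<or> (\<forall>V\<in>D. \<not> V \<subseteq> U')"
      "\<And>U'. U' \<in> G U n F \<Longrightarrow> (\<exists>x. U' = {x}) \<or> (\<forall>V\<in>F. \<not> V \<subseteq> U')"
    if "U \<in> A" "finite F" "F \<subseteq> A" for U n F
    using that by auto
  \<comment> \<open>The argument \<open>F\<close> serves both as the collection of sets to be
    covered and as the family to be avoided, so a family closed under \<open>\<Psi>\<close> contains
    the cover \<open>G U n F\<close> for every finite subfamily \<open>F\<close> and every
    \<open>U\<close> in \<open>F\<close>.\<close>
  define \<Psi> where "\<Psi> F = (\<Union>U\<in>F. \<Union>n. G U n F)" for F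
  have "\<And>F. finite F \<Longrightarrow> F \<subseteq> A \<Longrightarrow> countable (\<Phi> F \<union> \<Psi> F) \<and> \<Phi> F \<union> \<Psi> F \<subseteq> A"
  proof -
    fix F assume that: "finite F" "F \<subseteq> A"
    have "U \<in> A" if "U \<in> F" for U using that \<open>F \<subseteq> A\<close> by blast
    then have "finite (G U n F)" "G U n F \<subseteq> A" if "U \<in> F" for U n
      using G(1,2)[OF _ \<open>finite F\<close> \<open>F \<subseteq> A\<close>] that by simp_all
    then have "countable (\<Union>n. G U n F)" "(\<Union>n. G U n F) \<subseteq> A" if "U \<in> F" for U
      using that by (simp_all add: countable_finite UN_least)
    then have "countable (\<Psi> F)" "\<Psi> F \<subseteq> A"
      unfolding \<Psi>_def using countable_finite[OF \<open>finite F\<close>] by (auto intro: UN_least)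
    then show "countable (\<Phi> F \<union> \<Psi> F) \<and> \<Phi> F \<union> \<Psi> F \<subseteq> A" using \<Phi>[OF that] by simp
  qed
  then obtain M where M: "S \<subseteq> M" "M \<subseteq> A" "countable M" "closed_under (\<lambda>F. \<Phi> F \<union> \<Psi> F) M"
    using countable_closure[OF S, of "\<lambda>F. \<Phi> F \<union> \<Psi> F"] by blast
  define e where "e = to_nat_on M"
  \<comment> \<open>Avoiding the first \<open>e U + n\<close> members of \<open>M\<close> in the cover of \<open>K U n\<close> leaves each member
    of \<open>M\<close> with supersets in only finitely many of these covers.\<close>
  define F where "F U n = insert U {V\<in>M. e V \<le> e U + n}" for U and n :: nat
  have inj: "inj_on e M" unfolding e_def by (rule inj_on_to_nat_on[OF M(3)])
  have finM: "finite {V\<in>M. e V \<le> m}" for m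
    by (rule finite_imageD[OF finite_subset[of _ "{..m}"]]) (auto intro: inj_on_subset[OF inj])
  have F: "finite (F U n)" "F U n \<subseteq> M" "F U n \<subseteq> A" if "U \<in> M" for U n
    using finM that M(2) by (auto simp: F_def)
  \<comment> \<open>Covering sets that belong to \<open>D\<close> are left out: the old
    \<open>B\<close> already refines them.\<close>
  define B' where "B' = {W. (\<exists>U\<in>M. \<exists>n. W \<in> G U n (F U n)) \<and> (\<forall>V\<in>D. \<not> V \<subseteq> W)}"
  have GM: "G U n (F U n) \<subseteq> M" if "U \<in> M" for U n
  proof -
    have "\<Psi> (F U n) \<subseteq> M"
      using closed_underD[OF M(4) F(1,2)] that by blast
    then show ?thesis by (auto simp: \<Psi>_def F_def)
  qed
  then have B'M: "B' \<subseteq> M" by (auto simp: B'_def)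
  have ext: "end_extends D B (B \<union> B')"
    by (auto simp: end_extends_def B'_def)
  \<comment> \<open>\<open>V\<close> may be new. In each closed piece \<open>N\<close> of
    \<open>D\<close> it reflects to some \<open>V'\<close> in \<open>N\<close>, and the supersets of
    \<open>V\<close> in \<open>B\<close> that lie in \<open>N\<close> are among the finitely many
    supersets of \<open>V'\<close>.\<close>
  have finB: "finite {W\<in>B. V \<subseteq> W}" if V: "V \<in> A" for V
  proof -
    obtain \<N> where \<N>: "finite \<N>" "\<And>N. N \<in> \<N> \<Longrightarrow> N \<subseteq> A \<and> closed_under \<Phi> N" "D = \<Union>\<N>"
      using D by (auto simp: finitely_closed_def)
    have "finite {W\<in>B. W \<in> N \<and> V \<subseteq> W}" if N: "N \<in> \<N>" for N
    proof -
      obtain V' where V': "V' \<in> N" "\<And>W. W \<in> N \<Longrightarrow> V \<subseteq> W \<Longrightarrow> V' \<subseteq> W"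
        using supersets_reflect[OF _ _ V, of N] \<N>(2)[OF N] by blast
      have "finite {W\<in>B. V' \<subseteq> W}" using DB V'(1) N \<N>(3) by (auto simp: partial_base_def)
      then show ?thesis by (rule finite_subset[rotated]) (use V'(2) in auto)
    qed
    moreover have "{W\<in>B. V \<subseteq> W} = (\<Union>N\<in>\<N>. {W\<in>B. W \<in> N \<and> V \<subseteq> W})"
      using DB \<N>(3) by (auto simp: partial_base_def)
    ultimately show ?thesis using \<N>(1) by simp
  qed
  \<comment> \<open>Let \<open>V\<close> lie in a set \<open>W\<close> of the cover
    \<open>G U n (F U n)\<close>. If \<open>V\<close> was to be avoided, then \<open>W\<close> is a
    singleton and equals \<open>V\<close>. Otherwise \<open>e U + n < e V\<close>, which leaves
    finitely many pairs \<open>(U, n)\<close>.\<close>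
  have finB': "finite {W\<in>B'. V \<subseteq> W}" if V: "V \<in> M" for V
  proof -
    let ?I = "SIGMA U:{U\<in>M. e U \<le> e V}. {..e V}"
    have "{W\<in>B'. V \<subseteq> W} \<subseteq> insert V (\<Union>(U,n)\<in>?I. G U n (F U n))"
    proof
      fix W assume "W \<in> {W\<in>B'. V \<subseteq> W}"
      then obtain U n where U: "U \<in> M" "W \<in> G U n (F U n)" "V \<subseteq> W" by (auto simp: B'_def)
      show "W \<in> insert V (\<Union>(U,n)\<in>?I. G U n (F U n))"
      proof (cases "V \<in> F U n")
        case True
        then obtain x where "W = {x}" using G(6)[OF _ F(1,3)] U M(2) by blast
        then have "W = V" using U(3) V M(2) nonempty by (metis subset_iff subset_singletonD)
        then show ?thesis by simp
      next
        case False
        then have "e U + n < e V" using V by (auto simp: F_def)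
        then have "(U, n) \<in> ?I" using U(1) by auto
        then show ?thesis using U(2) by blast
      qed
    qed
    moreover have "finite ?I" using finM by (intro finite_SigmaI) auto
    then have "finite (insert V (\<Union>(U,n)\<in>?I. G U n (F U n)))"
      using G(1)[OF _ F(1,3)] M(2) by auto
    ultimately show ?thesis by (rule finite_subset)
  qed
  have pb: "partial_base (D \<union> M) (B \<union> B')"
    unfolding partial_base_def
  proof (intro conjI ballI)
    show "finitely_closed (D \<union> M)"
      using D M by (intro finitely_closed_Un) (auto simp: closed_under_Un_iff)
    show "B \<union> B' \<subseteq> D \<union> M" using DB B'M by (auto simp: partial_base_def)
  next
    fix V assume "V \<in> D \<union> M"
    moreover have "finite {W\<in>B'. V \<subseteq> W}" if "V \<in> D"
      using that by (auto simp: B'_def intro: rev_finite_subset[of "{}"])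
    ultimately have "finite {W\<in>B. V \<subseteq> W}" "finite {W\<in>B'. V \<subseteq> W}"
      using finB finB' M(2) finitely_closed_subset[OF D] by auto
    then have "finite ({W\<in>B. V \<subseteq> W} \<union> {W\<in>B'. V \<subseteq> W})" by simp
    then show "finite {W\<in>B \<union> B'. V \<subseteq> W}" by (rule rev_finite_subset) auto
  next
    fix V p assume V: "V \<in> D \<union> M" "p \<in> V"
    have old: "\<exists>U\<in>B. p \<in> U \<and> U \<subseteq> W" if "W \<in> D" "p \<in> W" for W
      using DB that by (auto simp: partial_base_def)
    show "\<exists>U\<in>B \<union> B'. p \<in> U \<and> U \<subseteq> V"
    proof (cases "V \<in> D")
      case True then show ?thesis using old V by blast
    next
      case False
      then have VM: "V \<in> M" "V \<in> A" using V M(2) by auto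
      obtain n where "p \<in> K V n" using K(2)[OF VM(2)] V(2) by blast
      then obtain W where W: "W \<in> G V n (F V n)" "p \<in> W"
        using G(3)[OF VM(2) F(1,3)[OF VM(1)], of n n] by blast
      have "W \<subseteq> V" using G(4)[OF VM(2) F(1,3)[OF VM(1)] W(1)] .
      \<comment> \<open>The covering set \<open>W\<close> around \<open>p\<close> is either refined
        by a member of \<open>B\<close> or is itself a new set.\<close>
      show ?thesis
      proof (cases "W \<in> D")
        case True then show ?thesis using old[OF True W(2)] \<open>W \<subseteq> V\<close> by (meson UnI1 subset_trans)
      next
        case False
        then have "\<forall>V'\<in>D. \<not> V' \<subseteq> W" using G(5)[OF VM(2) F(1,3)[OF VM(1)] W(1)] by simp
        then have "W \<in> B'" unfolding B'_def using W(1) VM(1) by blast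
        then show ?thesis using W(2) \<open>W \<subseteq> V\<close> by (meson UnI2)
      qed
    qed
  qed
  have "closed_under \<Phi> M" using M(4) by (simp add: closed_under_Un_iff)
  then show thesis by (rule that[OF M(1-3) _ pb ext])
qed

section \<open>Transfinite extension\<close>

text \<open>The limit step: every superset of a member of \<open>D \<union> N k\<close> in the union
  already lies in \<open>C k\<close>, so both requirements are inherited from single stages.
  \<open>B\<close> is listed separately because \<open>K\<close> may be empty, as it is at the first
  stage of the recursion in \<open>extend\<close>.\<close>

lemma partial_base_chain:
  assumes DB: "partial_base D B"
    and pb: "\<And>k. k \<in> K \<Longrightarrow> N k \<subseteq> A \<and> closed_under \<Phi> (N k) \<and> partial_base (D \<union> N k) (C k) \<and> end_extends D B (C k)"
    and chain: "\<And>j k. j \<in> K \<Longrightarrow> k \<in> K \<Longrightarrow> (N j \<subseteq> N k \<and> end_extends (D \<union> N j) (C j) (C k)) \<or>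
                  (N k \<subseteq> N j \<and> end_extends (D \<union> N k) (C k) (C j))"
  shows "partial_base (D \<union> (\<Union>k\<in>K. N k)) (B \<union> (\<Union>k\<in>K. C k))"
    and "end_extends D B (B \<union> (\<Union>k\<in>K. C k))"
    and "\<And>k. k \<in> K \<Longrightarrow> end_extends (D \<union> N k) (C k) (B \<union> (\<Union>k\<in>K. C k))"
proof -
  have "B \<subseteq> C k \<and> (\<forall>W\<in>C k - B. \<forall>V\<in>D. \<not> V \<subseteq> W)" if "k \<in> K" for k
    using pb[OF that] by (simp add: end_extends_def)
  then show ext: "end_extends D B (B \<union> (\<Union>k\<in>K. C k))"
    unfolding end_extends_def by blast
  show ext': "end_extends (D \<union> N k) (C k) (B \<union> (\<Union>k\<in>K. C k))" if k: "k \<in> K" for k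
    unfolding end_extends_def
  proof (intro conjI ballI)
    show "C k \<subseteq> B \<union> (\<Union>k\<in>K. C k)" using k by blast
  next
    fix W V assume W: "W \<in> B \<union> (\<Union>k\<in>K. C k) - C k" and V: "V \<in> D \<union> N k"
    have "B \<subseteq> C k" using pb[OF k] by (simp add: end_extends_def)
    \<comment> \<open>Since \<open>W\<close> is in \<open>C j\<close> but not in \<open>C k\<close>,
      comparability yields that \<open>C j\<close> end-extends \<open>C k\<close>.\<close>
    then obtain j where j: "j \<in> K" "W \<in> C j" "W \<notin> C k" using W by auto
    then have "end_extends (D \<union> N k) (C k) (C j)"
      using chain[OF k j(1)] by (auto simp: end_extends_def)
    then show "\<not> V \<subseteq> W" using j V by (simp add: end_extends_def)
  qed
  have D: "finitely_closed D" "D \<subseteq> A"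
    using DB finitely_closed_subset by (auto simp: partial_base_def)
  show "partial_base (D \<union> (\<Union>k\<in>K. N k)) (B \<union> (\<Union>k\<in>K. C k))"
    unfolding partial_base_def
  proof (intro conjI ballI)
    \<comment> \<open>The whole chain contributes only one further closed piece, namely its
      union.\<close>
    show "finitely_closed (D \<union> (\<Union>k\<in>K. N k))"
    proof (cases "K = {}")
      case True then show ?thesis using D by simp
    next
      case False
      then show ?thesis
        using pb chain by (intro finitely_closed_Un D closed_under_Union_chain) blast+
    qed
    show "B \<union> (\<Union>k\<in>K. C k) \<subseteq> D \<union> (\<Union>k\<in>K. N k)"
    proof (rule Un_least)
      show "B \<subseteq> D \<union> (\<Union>k\<in>K. N k)" using DB by (auto simp: partial_base_def)
      have "C k \<subseteq> D \<union> N k" if "k \<in> K" for k using pb[OF that] by (simp add: partial_base_def)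
      then show "(\<Union>k\<in>K. C k) \<subseteq> D \<union> (\<Union>k\<in>K. N k)" by fast
    qed
  next
    fix U assume "U \<in> D \<union> (\<Union>k\<in>K. N k)"
    then consider "U \<in> D" | k where "k \<in> K" "U \<in> N k" by blast
    then show "finite {W \<in> B \<union> (\<Union>k\<in>K. C k). U \<subseteq> W}"
    proof cases
      case 1
      then have "{W \<in> B \<union> (\<Union>k\<in>K. C k). U \<subseteq> W} = {W\<in>B. U \<subseteq> W}"
        using ext by (auto simp: end_extends_def)
      then show ?thesis using DB 1 by (simp add: partial_base_def)
    next
      case 2
      then have "{W \<in> B \<union> (\<Union>k\<in>K. C k). U \<subseteq> W} = {W\<in>C k. U \<subseteq> W}"
        using ext'[OF 2(1)] by (auto simp: end_extends_def)
      then show ?thesis using pb[OF 2(1)] 2 by (simp add: partial_base_def)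
    qed
  next
    fix V p assume V: "V \<in> D \<union> (\<Union>k\<in>K. N k)" "p \<in> V"
    then consider "V \<in> D" | k where "k \<in> K" "V \<in> N k" by blast
    then show "\<exists>U\<in>B \<union> (\<Union>k\<in>K. C k). p \<in> U \<and> U \<subseteq> V"
    proof cases
      case 1
      then have "\<forall>p\<in>V. \<exists>U\<in>B. p \<in> U \<and> U \<subseteq> V" using DB by (simp add: partial_base_def)
      then show ?thesis using V(2) by (meson UnI1)
    next
      case 2
      then have "\<forall>p\<in>V. \<exists>U\<in>C k. p \<in> U \<and> U \<subseteq> V"
        using pb[OF 2(1)] by (simp add: partial_base_def)
      then obtain U where "U \<in> C k" "p \<in> U" "U \<subseteq> V" using V(2) by blast
      then show ?thesis using 2 by blast
    qed
  qed
qed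

text \<open>Induction on the cardinality of \<open>S\<close>, for all \<open>D\<close> and
  \<open>B\<close> simultaneously, because the induction hypothesis is applied over the enlarged
  family \<open>D \<union> N0 \<xi>\<close>. The bound on \<open>N\<close>, with a copy of the
  naturals added to cover finite \<open>S\<close>, keeps the stages of the recursion smaller than an
  uncountable \<open>S\<close>.\<close>

lemma extend:
  assumes "partial_base D B" "S \<subseteq> A"
  shows "\<exists>N B'. S \<subseteq> N \<and> N \<subseteq> A \<and> closed_under \<Phi> N \<and> |N| \<le>o |S <+> (UNIV::nat set)| \<and>
    partial_base (D \<union> N) B' \<and> end_extends D B B'"
  using assms
proof (induct S arbitrary: D B rule: wf_induct_rule[OF wf_inv_image[OF wf_ordLess, of card_of]])
  case (1 S)
  have IH: "\<exists>N B'. S' \<subseteq> N \<and> N \<subseteq> A \<and> closed_under \<Phi> N \<and> |N| \<le>o |S' <+> (UNIV::nat set)| \<and>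
    partial_base (D' \<union> N) B' \<and> end_extends D' B'' B'"
    if "|S'| <o |S|" "partial_base D' B''" "S' \<subseteq> A" for S' D' B''
    using 1(1)[of S' D' B''] that by (simp add: in_inv_image)
  show ?case
  proof (cases "countable S")
    case True
    obtain M B' where M: "S \<subseteq> M" "M \<subseteq> A" "countable M" "closed_under \<Phi> M"
        "partial_base (D \<union> M) B'" "end_extends D B B'"
      using extend_countable[OF 1(2) True 1(3)] by blast
    have "|M| \<le>o |UNIV::nat set|"
      using M(3) by (simp add: countable_def card_of_ordLeq[symmetric])
    then have "|M| \<le>o |S <+> (UNIV::nat set)|"
      using card_of_Plus2 ordLeq_transitive by blast
    then show ?thesis using M by blast
  next
    case False
    \<comment> \<open>As a cardinal order on \<open>S\<close>, \<open>r\<close> has only initial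
      segments of smaller cardinality than \<open>S\<close>.\<close>
    define r where "r = |S|"
    have r: "Well_order r" "Field r = S" "Card_order r" "wf (r - Id)"
      using card_of_well_order_on[of S] card_of_Card_order[of S]
      by (auto simp: r_def Field_card_of well_order_on_def)
    have inf: "infinite S" using False countable_finite by blast
    have natS: "|UNIV::nat set| <o |S|"
      using False not_ordLeq_iff_ordLess[OF card_of_Well_order card_of_Well_order, of S "UNIV::nat set"]
      by (simp add: countable_def card_of_ordLeq[symmetric])
    have underS: "|underS r \<xi>| <o |S|" if "\<xi> \<in> S" for \<xi>
      using card_of_underS[OF r(3)] that r(2) by (simp add: r_def)
    \<comment> \<open>\<open>p\<close> pairs the next closed family with its partial base;
      \<open>N0\<close> and \<open>B0\<close> stand for the unions over the earlier stages.\<close>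
    define good where "good N0 B0 \<xi> p \<longleftrightarrow> insert \<xi> N0 \<subseteq> fst p \<and> fst p \<subseteq> A \<and> closed_under \<Phi> (fst p) \<and>
        |fst p| \<le>o |insert \<xi> N0 <+> (UNIV::nat set)| \<and>
        partial_base (D \<union> fst p) (snd p) \<and> end_extends (D \<union> N0) B0 (snd p)" for N0 B0 \<xi> p
    \<comment> \<open>That the \<open>SOME\<close> has a witness depends on the earlier stages, so
      this is proved along with the invariant \<open>inv\<close>.\<close>
    define g where "g = wfrec (r - Id) (\<lambda>g \<xi>. SOME p.
        good (\<Union>\<eta>\<in>underS r \<xi>. fst (g \<eta>)) (B \<union> (\<Union>\<eta>\<in>underS r \<xi>. snd (g \<eta>))) \<xi> p)"
    define N where "N \<xi> = fst (g \<xi>)" for \<xi>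
    define C where "C \<xi> = snd (g \<xi>)" for \<xi>
    define N0 where "N0 \<xi> = (\<Union>\<eta>\<in>underS r \<xi>. N \<eta>)" for \<xi>
    define C0 where "C0 \<xi> = B \<union> (\<Union>\<eta>\<in>underS r \<xi>. C \<eta>)" for \<xi>
    have cut: "cut g (r - Id) \<xi> \<eta> = g \<eta>" if "\<eta> \<in> underS r \<xi>" for \<xi> \<eta>
      using that by (simp add: cut_apply underS_def)
    have g: "g \<xi> = (SOME p. good (N0 \<xi>) (C0 \<xi>) \<xi> p)" for \<xi>
      unfolding N0_def C0_def N_def C_def
      by (subst g_def, subst wfrec[OF r(4)], fold g_def) (simp add: cut cong: SUP_cong)
    \<comment> \<open>The size of \<open>N \<xi>\<close> is measured by the initial segment below
      \<open>\<xi>\<close>, which makes the union \<open>N0\<close> of earlier stages smaller than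
      \<open>S\<close>.\<close>
    define inv where "inv \<xi> \<longleftrightarrow> \<xi> \<in> N \<xi> \<and> N \<xi> \<subseteq> A \<and> closed_under \<Phi> (N \<xi>) \<and>
        |N \<xi>| \<le>o |underS r \<xi> <+> (UNIV::nat set)| \<and>
        partial_base (D \<union> N \<xi>) (C \<xi>) \<and> end_extends D B (C \<xi>) \<and>
        (\<forall>\<eta>\<in>underS r \<xi>. N \<eta> \<subseteq> N \<xi> \<and> end_extends (D \<union> N \<eta>) (C \<eta>) (C \<xi>))" for \<xi>
    have linear: "\<eta> = \<zeta> \<or> \<eta> \<in> underS r \<zeta> \<or> \<zeta> \<in> underS r \<eta>" if "\<eta> \<in> S" "\<zeta> \<in> S" for \<eta> \<zeta>
      using r(1,2) that unfolding well_order_on_def linear_order_on_def total_on_def underS_def by blast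
    have chain: "(N j \<subseteq> N k \<and> end_extends (D \<union> N j) (C j) (C k)) \<or> (N k \<subseteq> N j \<and> end_extends (D \<union> N k) (C k) (C j))"
      if "inv j" "inv k" "j \<in> S" "k \<in> S" for j k
      using linear[OF that(3,4)] that(1,2) end_extends_refl unfolding inv_def by blast
    have inv: "\<xi> \<in> S \<Longrightarrow> inv \<xi>" for \<xi>
    proof (induct \<xi> rule: wf_induct_rule[OF r(4)])
      case (1 \<xi>)
      let ?T = "underS r \<xi> <+> (UNIV::nat set)"
      have US: "\<eta> \<in> S" "inv \<eta>" if "\<eta> \<in> underS r \<xi>" for \<eta>
      proof -
        show "\<eta> \<in> S" using that r(2) by (auto simp: underS_def Field_def)
        then show "inv \<eta>" using 1 that by (simp add: underS_def)
      qed
      have pb: "N k \<subseteq> A \<and> closed_under \<Phi> (N k) \<and> partial_base (D \<union> N k) (C k) \<and> end_extends D B (C k)"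
        if "k \<in> underS r \<xi>" for k
        using US(2)[OF that] by (simp add: inv_def)
      have ch: "(N j \<subseteq> N k \<and> end_extends (D \<union> N j) (C j) (C k)) \<or> (N k \<subseteq> N j \<and> end_extends (D \<union> N k) (C k) (C j))"
        if "j \<in> underS r \<xi>" "k \<in> underS r \<xi>" for j k
        using chain US that by simp
      have lim: "partial_base (D \<union> N0 \<xi>) (C0 \<xi>)" "end_extends D B (C0 \<xi>)"
          "\<And>k. k \<in> underS r \<xi> \<Longrightarrow> end_extends (D \<union> N k) (C k) (C0 \<xi>)"
        unfolding N0_def C0_def
        by (rule partial_base_chain[OF \<open>partial_base D B\<close> pb ch]; assumption)+
      have infT: "infinite ?T" by simp
      have T: "|?T| <o |S|"
        using card_of_Plus_ordLess_infinite[OF inf underS[OF 1(2)] natS] .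
      \<comment> \<open>An infinite cardinal bounds both the number of earlier stages and the size
        of each.\<close>
      have "|N0 \<xi>| \<le>o |?T|"
        unfolding N0_def
      proof (rule card_of_UNION_ordLeq_infinite[OF infT card_of_Plus1], rule ballI)
        fix \<eta> assume \<eta>: "\<eta> \<in> underS r \<xi>"
        then have "|N \<eta>| \<le>o |underS r \<eta> <+> (UNIV::nat set)|" using US by (simp add: inv_def)
        moreover have "underS r \<eta> \<subseteq> underS r \<xi>"
          using \<eta> r(1) by (auto simp: underS_def well_order_on_def linear_order_on_def partial_order_on_def
              preorder_on_def dest: transD antisymD)
        then have "|underS r \<eta> <+> (UNIV::nat set)| \<le>o |?T|"
          by (intro card_of_mono1) auto
        ultimately show "|N \<eta>| \<le>o |?T|" by (rule ordLeq_transitive)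
      qed
      moreover have "|{\<xi>}| \<le>o |?T|"
        using card_of_singl_ordLeq[of ?T \<xi>] infT by auto
      ultimately have N0: "|insert \<xi> (N0 \<xi>)| \<le>o |?T|"
        using card_of_Un_ordLeq_infinite_Field[OF _ _ _ card_of_Card_order, of ?T "{\<xi>}" "N0 \<xi>"] infT
        by (simp add: Field_card_of)
      then have small: "|insert \<xi> (N0 \<xi>)| <o |S|" using T ordLeq_ordLess_trans by blast
      have "insert \<xi> (N0 \<xi>) \<subseteq> A" using pb 1(2) \<open>S \<subseteq> A\<close> by (auto simp: N0_def)
      then have "\<exists>N B'. insert \<xi> (N0 \<xi>) \<subseteq> N \<and> N \<subseteq> A \<and> closed_under \<Phi> N \<and>
          |N| \<le>o |insert \<xi> (N0 \<xi>) <+> (UNIV::nat set)| \<and>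
          partial_base (D \<union> N0 \<xi> \<union> N) B' \<and> end_extends (D \<union> N0 \<xi>) (C0 \<xi>) B'"
        by (rule IH[OF small lim(1)])
      then obtain N' B' where N': "insert \<xi> (N0 \<xi>) \<subseteq> N'" "N' \<subseteq> A" "closed_under \<Phi> N'"
          "|N'| \<le>o |insert \<xi> (N0 \<xi>) <+> (UNIV::nat set)|"
          "partial_base (D \<union> N0 \<xi> \<union> N') B'" "end_extends (D \<union> N0 \<xi>) (C0 \<xi>) B'"
        by (elim exE conjE)
      \<comment> \<open>The induction hypothesis was used over \<open>D \<union> N0 \<xi>\<close>.
        As \<open>N'\<close> absorbs \<open>N0 \<xi>\<close>, the result is again \<open>D\<close>
        plus a single closed family.\<close>
      have "D \<union> N0 \<xi> \<union> N' = D \<union> N'" using N'(1) by blast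
      then have "good (N0 \<xi>) (C0 \<xi>) \<xi> (N', B')" using N' by (simp add: good_def)
      then have good: "good (N0 \<xi>) (C0 \<xi>) \<xi> (g \<xi>)" unfolding g by (rule someI)
      have "|insert \<xi> (N0 \<xi>) <+> (UNIV::nat set)| \<le>o |?T|"
        using card_of_Plus_ordLeq_infinite_Field[OF _ N0 card_of_Plus2 card_of_Card_order] infT
        by (simp add: Field_card_of)
      then have "|N \<xi>| \<le>o |?T|"
        using good ordLeq_transitive by (auto simp: good_def N_def)
      moreover have "end_extends D B (C \<xi>)"
        using end_extends_trans[OF lim(2), of "D \<union> N0 \<xi>" "C \<xi>"] good by (simp add: good_def C_def)
      moreover have "N \<eta> \<subseteq> N \<xi>" "end_extends (D \<union> N \<eta>) (C \<eta>) (C \<xi>)" if "\<eta> \<in> underS r \<xi>" for \<eta>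
      proof -
        have "N \<eta> \<subseteq> N0 \<xi>" using that by (auto simp: N0_def)
        then show "N \<eta> \<subseteq> N \<xi>" using good by (auto simp: good_def N_def)
        have "D \<union> N \<eta> \<subseteq> D \<union> N0 \<xi>" using \<open>N \<eta> \<subseteq> N0 \<xi>\<close> by blast
        then show "end_extends (D \<union> N \<eta>) (C \<eta>) (C \<xi>)"
          using end_extends_trans[OF lim(3)[OF that], of "D \<union> N0 \<xi>" "C \<xi>"] good by (simp add: good_def C_def)
      qed
      ultimately show ?case using good by (simp add: inv_def good_def N_def C_def)
    qed
    \<comment> \<open>One last limit step takes the union over all of \<open>S\<close>.\<close>
    have pb: "N k \<subseteq> A \<and> closed_under \<Phi> (N k) \<and> partial_base (D \<union> N k) (C k) \<and> end_extends D B (C k)"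
      if "k \<in> S" for k
      using inv[OF that] by (simp add: inv_def)
    have ch: "(N j \<subseteq> N k \<and> end_extends (D \<union> N j) (C j) (C k)) \<or> (N k \<subseteq> N j \<and> end_extends (D \<union> N k) (C k) (C j))"
      if "j \<in> S" "k \<in> S" for j k
      using chain inv that by simp
    have lim: "partial_base (D \<union> (\<Union>\<xi>\<in>S. N \<xi>)) (B \<union> (\<Union>\<xi>\<in>S. C \<xi>))" "end_extends D B (B \<union> (\<Union>\<xi>\<in>S. C \<xi>))"
        "\<And>k. k \<in> S \<Longrightarrow> end_extends (D \<union> N k) (C k) (B \<union> (\<Union>\<xi>\<in>S. C \<xi>))"
      by (rule partial_base_chain[OF \<open>partial_base D B\<close> pb ch]; assumption)+
    let ?N = "\<Union>\<xi>\<in>S. N \<xi>"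
    have "S \<subseteq> ?N" using inv by (auto simp: inv_def)
    moreover have "?N \<subseteq> A" using pb by blast
    moreover have "closed_under \<Phi> ?N"
    proof (rule closed_under_Union_chain)
      show "N ` S \<noteq> {}" using inf by auto
      show "closed_under \<Phi> M" if "M \<in> N ` S" for M using that pb by auto
      show "M \<subseteq> M' \<or> M' \<subseteq> M" if "M \<in> N ` S" "M' \<in> N ` S" for M M' using that ch by blast
    qed
    moreover have "|?N| \<le>o |S <+> (UNIV::nat set)|"
    proof (rule card_of_UNION_ordLeq_infinite[OF _ card_of_Plus1], simp, rule ballI)
      fix \<xi> assume \<xi>: "\<xi> \<in> S"
      then have "|N \<xi>| \<le>o |underS r \<xi> <+> (UNIV::nat set)|" using inv by (simp add: inv_def)
      moreover have "underS r \<xi> \<subseteq> S" using r(2) by (auto simp: underS_def Field_def)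
      then have "|underS r \<xi> <+> (UNIV::nat set)| \<le>o |S <+> (UNIV::nat set)|"
        by (intro card_of_mono1) auto
      ultimately show "|N \<xi>| \<le>o |S <+> (UNIV::nat set)|" by (rule ordLeq_transitive)
    qed
    ultimately show ?thesis using lim(1,2) by (intro exI conjI)
  qed
qed

text \<open>Extending the empty partial base by \<open>S = A\<close> forces
  \<open>N = A\<close>.\<close>

lemma noetherian_subbase:
  "\<exists>B\<subseteq>A. is_base X B \<and> op_like natLeq B"
proof -
  obtain N B where "A \<subseteq> N" "N \<subseteq> A" and B: "partial_base N B"
    using extend[OF partial_base_empty subset_refl] by auto
  then have "N = A" by blast
  with B have B: "B \<subseteq> A" "\<And>U. U \<in> A \<Longrightarrow> finite {W\<in>B. U \<subseteq> W}"
      "\<And>V p. V \<in> A \<Longrightarrow> p \<in> V \<Longrightarrow> \<exists>U\<in>B. p \<in> U \<and> U \<subseteq> V"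
    by (auto simp: partial_base_def)
  have "is_base X B"
    unfolding is_base_def
  proof (intro conjI allI impI ballI)
    show "openin X U" if "U \<in> B" for U using A_open B(1) that by blast
  next
    fix U x assume "openin X U" "x \<in> U"
    then obtain V where "V \<in> A" "x \<in> V" "V \<subseteq> U" using A_nhd by blast
    then show "\<exists>V\<in>B. x \<in> V \<and> V \<subseteq> U" using B(3) by (meson subset_trans)
  qed
  moreover have "op_like natLeq B"
    using B(1,2) by (auto simp: op_like_def finite_iff_ordLess_natLeq[symmetric])
  ultimately show ?thesis using B(1) by blast
qed

end

section \<open>Cozero sets and countably many supersets\<close>

lemma cozero_set_openin: "cozero_set X U \<Longrightarrow> openin X U"
proof -
  assume "cozero_set X U"
  then obtain f where f: "continuous_map X euclideanreal f" "U = topspace X - {x \<in> topspace X. f x = 0}"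
    by (auto simp: cozero_set_def)
  have "U = {x \<in> topspace X. f x \<in> - {0}}" using f(2) by auto
  then show "openin X U" using openin_continuous_map_preimage[OF f(1), of "- {0}"]
    by (simp add: open_Compl)
qed

text \<open>The sets where the absolute value of \<open>f\<close> is at least \<open>1/(n+1)\<close>
  are closed, hence compact, and exhaust \<open>U\<close>.\<close>

lemma cozero_set_sigma_compact:
  assumes "compact_space X" "cozero_set X U"
  shows "\<exists>K::nat \<Rightarrow> 'a set. (\<forall>n. compactin X (K n)) \<and> U = (\<Union>n. K n)"
proof -
  obtain f where f: "continuous_map X euclideanreal f" "U = topspace X - {x \<in> topspace X. f x = 0}"
    using assms(2) by (auto simp: cozero_set_def)
  define K where "K n = {x \<in> topspace X. f x \<in> {y. inverse (real (Suc n)) \<le> \<bar>y\<bar>}}" for n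
  have "compactin X (K n)" for n
  proof -
    have "closed {y::real. inverse (real (Suc n)) \<le> \<bar>y\<bar>}" by (intro closed_Collect_le continuous_intros)
    then have "closedin X (K n)"
      unfolding K_def by (intro closedin_continuous_map_preimage[OF f(1)]) simp
    then show ?thesis using closedin_compact_space assms(1) by blast
  qed
  moreover have "x \<in> U \<longleftrightarrow> (\<exists>n. x \<in> K n)" for x
  proof (cases "x \<in> topspace X \<and> f x \<noteq> 0")
    case True
    then obtain n where "inverse (real (Suc n)) < \<bar>f x\<bar>" using reals_Archimedean[of "\<bar>f x\<bar>"] by auto
    then show ?thesis using True f(2) by (auto simp: K_def intro!: exI[of _ n])
  next
    case False then show ?thesis using f(2) by (auto simp: K_def)
  qed
  then have "U = (\<Union>n. K n)" by blast
  ultimately show ?thesis by blast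
qed

text \<open>Compact Hausdorff spaces are completely regular. This supplies a base to which the first
  claim of the theorem can be applied when proving the second.\<close>

lemma is_base_cozero_sets:
  assumes "compact_space X" "Hausdorff_space X"
  shows "is_base X (Collect (cozero_set X))"
  unfolding is_base_def
proof (intro conjI ballI allI impI)
  show "openin X U" if "U \<in> Collect (cozero_set X)" for U using that cozero_set_openin by blast
next
  fix U x assume U: "openin X U" "x \<in> U"
  have "completely_regular_space X"
    using assms by (intro normal_imp_completely_regular_space compact_Hausdorff_or_regular_imp_normal_space) auto
  moreover have "closedin X (topspace X - U)" "x \<in> topspace X - (topspace X - U)"
    using U openin_subset by fastforce+
  ultimately obtain f where f: "continuous_map X (top_of_set {0..1::real}) f" "f x = 0" "f ` (topspace X - U) \<subseteq> {1}"
    unfolding completely_regular_space_def by metis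
  define g where "g y = 1 - f y" for y
  have "continuous_map X euclideanreal g"
    unfolding g_def using f(1) by (intro continuous_intros) (auto simp: continuous_map_in_subtopology)
  then have "cozero_set X (topspace X - {y \<in> topspace X. g y = 0})" by (auto simp: cozero_set_def)
  moreover have "topspace X - {y \<in> topspace X. g y = 0} \<subseteq> U" using f(3) by (auto simp: g_def)
  moreover have "x \<in> topspace X - {y \<in> topspace X. g y = 0}" using f(2) U openin_subset by (auto simp: g_def)
  ultimately show "\<exists>V\<in>Collect (cozero_set X). x \<in> V \<and> V \<subseteq> U" by (meson mem_Collect_eq)
qed

text \<open>A nonempty open \<open>V\<close> contains some \<open>W0\<close> in \<open>Q\<close>.
  Every superset of \<open>V\<close> is one of \<open>W0\<close>, and fewer than omega1 many means
  countably many.\<close>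

lemma Nt_le_omega1_imp_countable_supersets:
  assumes "Nt_le X omega1"
  shows "\<exists>Q. is_base X Q \<and> (\<forall>V. openin X V \<longrightarrow> V \<noteq> {} \<longrightarrow> countable {W\<in>Q. V \<subseteq> W})"
proof -
  obtain \<nu> :: "nat set rel" and Q
    where \<nu>: "\<nu> \<le>o omega1" and Q: "is_base X Q" "op_like \<nu> Q"
    using assms by (auto simp: Nt_le_def)
  have "countable {W\<in>Q. V \<subseteq> W}" if V: "openin X V" "V \<noteq> {}" for V
  proof -
    obtain x where "x \<in> V" using V by blast
    then obtain W0 where W0: "W0 \<in> Q" "W0 \<subseteq> V" using Q(1) V(1) unfolding is_base_def by meson
    then have "|{W\<in>Q. W0 \<subseteq> W}| <o \<nu>"
      using Q(2) by (simp add: op_like_def)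
    then have "|{W\<in>Q. W0 \<subseteq> W}| <o omega1" using \<nu> by (rule ordLess_ordLeq_trans)
    then have "|{W\<in>Q. W0 \<subseteq> W}| \<le>o natLeq"
      using cardSuc_ordLeq_ordLess[OF natLeq_Card_order card_of_Card_order] by blast
    then have "|{W\<in>Q. W0 \<subseteq> W}| \<le>o |UNIV::nat set|"
      using card_of_nat ordIso_symmetric ordLeq_ordIso_trans by blast
    then have "countable {W\<in>Q. W0 \<subseteq> W}" by (simp add: countable_def card_of_ordLeq[symmetric])
    then show ?thesis by (rule countable_subset[rotated]) (use W0 in auto)
  qed
  then show ?thesis using Q by blast
qed

section \<open>Reflection of local bases\<close>

text \<open>For each pair of supersets \<open>W1\<close>, \<open>W\<close> of \<open>U\<close> in
  \<open>Q\<close> such that the closure of \<open>W1\<close> lies in \<open>W\<close>,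
  \<open>\<Phi>\<close> adds a finite cover of that closure by members of \<open>A\<close> inside
  \<open>W\<close>. Given \<open>q\<close> and \<open>P\<close>, regularity provides such a pair
  with \<open>q\<close> in \<open>W1\<close> and \<open>W\<close> inside \<open>P\<close>. Any
  \<open>U\<close> in \<open>N\<close> below \<open>W1\<close> then brings the cover into
  \<open>N\<close>, and one of its sets contains \<open>q\<close>.\<close>

lemma local_base_reflection:
  assumes "compact_space X" "Hausdorff_space X" and A: "is_base X A" "{} \<notin> A"
    and Q: "is_base X Q" "\<And>V. openin X V \<Longrightarrow> V \<noteq> {} \<Longrightarrow> countable {W\<in>Q. V \<subseteq> W}"
  obtains \<Phi> where "\<And>F. finite F \<Longrightarrow> F \<subseteq> A \<Longrightarrow> countable (\<Phi> F) \<and> \<Phi> F \<subseteq> A"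
    "\<And>N q P. N \<subseteq> A \<Longrightarrow> closed_under \<Phi> N \<Longrightarrow> (\<And>P. openin X P \<Longrightarrow> q \<in> P \<Longrightarrow> \<exists>V\<in>N. V \<subseteq> P) \<Longrightarrow>
        openin X P \<Longrightarrow> q \<in> P \<Longrightarrow> \<exists>V\<in>N. q \<in> V \<and> V \<subseteq> P"
proof -
  have regular: "regular_space X" using assms compact_Hausdorff_imp_regular_space by blast
  have cover: "\<exists>G. finite G \<and> G \<subseteq> A \<and> C \<subseteq> \<Union>G \<and> (\<forall>U\<in>G. U \<subseteq> W)" if C: "closedin X C" "C \<subseteq> W" "openin X W" for C W
  proof -
    have "C \<subseteq> \<Union>{U\<in>A. U \<subseteq> W}" using A(1) C unfolding is_base_def by blast
    moreover have "Ball {U\<in>A. U \<subseteq> W} (openin X)" using A(1) by (auto simp: is_base_def)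
    moreover have "compactin X C" using closedin_compact_space assms(1) C(1) by blast
    ultimately obtain G where "finite G" "G \<subseteq> {U\<in>A. U \<subseteq> W}" "C \<subseteq> \<Union>G"
      unfolding compactin_def by meson
    then show ?thesis by (intro exI[of _ G]) auto
  qed
  define G where "G C W = (SOME G. finite G \<and> G \<subseteq> A \<and> C \<subseteq> \<Union>G \<and> (\<forall>U\<in>G. U \<subseteq> W))" for C W
  have G: "finite (G C W)" "G C W \<subseteq> A" "C \<subseteq> \<Union>(G C W)" "\<And>U. U \<in> G C W \<Longrightarrow> U \<subseteq> W"
    if "closedin X C" "C \<subseteq> W" "openin X W" for C W
    using someI_ex[OF cover[OF that]] by (simp_all add: G_def)
  define S where "S U = {W\<in>Q. U \<subseteq> W}" for U
  define pairs where "pairs U = {(W1, W) \<in> S U \<times> S U. X closure_of W1 \<subseteq> W}" for U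
  define \<Phi> where "\<Phi> F = (\<Union>U\<in>F. \<Union>(W1, W)\<in>pairs U. G (X closure_of W1) W)" for F
  have pairs: "finite (G (X closure_of W1) W)" "G (X closure_of W1) W \<subseteq> A"
    if "(W1, W) \<in> pairs U" for U W1 W
  proof -
    have "X closure_of W1 \<subseteq> W" "openin X W" using that Q(1) by (auto simp: pairs_def S_def is_base_def)
    then show "finite (G (X closure_of W1) W)" "G (X closure_of W1) W \<subseteq> A"
      using G(1,2)[OF closedin_closure_of] by auto
  qed
  have ctbl: "countable (pairs U)" if "U \<in> A" for U
  proof -
    have "countable (S U)" unfolding S_def using Q(2) A that unfolding is_base_def by metis
    then have "countable (S U \<times> S U)" by (intro countable_SIGMA) auto
    then show ?thesis by (rule countable_subset[rotated]) (auto simp: pairs_def)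
  qed
  have 1: "countable (\<Phi> F) \<and> \<Phi> F \<subseteq> A" if F: "finite F" "F \<subseteq> A" for F
  proof
    have "countable (\<Union>(W1, W)\<in>pairs U. G (X closure_of W1) W)" if "U \<in> F" for U
      using ctbl[of U] that F(2) pairs(1) by (intro countable_UN) (auto intro: countable_finite)
    then show "countable (\<Phi> F)" unfolding \<Phi>_def using countable_finite[OF F(1)] by (rule countable_UN[rotated])
    show "\<Phi> F \<subseteq> A" unfolding \<Phi>_def using pairs(2) by fast
  qed
  have 2: "\<exists>V\<in>N. q \<in> V \<and> V \<subseteq> P"
    if N: "N \<subseteq> A" "closed_under \<Phi> N" and q: "\<And>P. openin X P \<Longrightarrow> q \<in> P \<Longrightarrow> \<exists>V\<in>N. V \<subseteq> P"
      and P: "openin X P" "q \<in> P" for N q P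
  proof -
    obtain W where W: "W \<in> Q" "q \<in> W" "W \<subseteq> P" using Q(1) P unfolding is_base_def by blast
    then have "openin X W" using Q(1) by (auto simp: is_base_def)
    then obtain V C where V: "openin X V" "closedin X C" "q \<in> V" "V \<subseteq> C" "C \<subseteq> W"
      using regular W(2) unfolding neighbourhood_base_of_closedin[symmetric] neighbourhood_base_of by metis
    obtain W1 where W1: "W1 \<in> Q" "q \<in> W1" "W1 \<subseteq> V" using Q(1) V unfolding is_base_def by blast
    have cl: "X closure_of W1 \<subseteq> W" using closure_of_minimal[of W1 C X] V W1 by blast
    have "openin X W1" using Q(1) W1 by (auto simp: is_base_def)
    then obtain U where U: "U \<in> N" "U \<subseteq> W1" using q W1(2) by blast
    have "W1 \<subseteq> W" using W1 V by blast
    then have "(W1, W) \<in> pairs U" using U(2) W1(1) W(1) cl by (auto simp: pairs_def S_def)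
    then have "G (X closure_of W1) W \<subseteq> \<Phi> {U}" unfolding \<Phi>_def by blast
    also have "\<dots> \<subseteq> N" using closed_underD[OF N(2)] U(1) by blast
    finally have "G (X closure_of W1) W \<subseteq> N" .
    moreover have "q \<in> X closure_of W1"
      using closure_of_subset[OF openin_subset[OF \<open>openin X W1\<close>]] W1(2) by blast
    ultimately show ?thesis
      using G(3,4)[OF closedin_closure_of cl \<open>openin X W\<close>] W(3) by (meson UnionE subset_iff)
  qed
  show thesis using 1 2 by (rule that)
qed

section \<open>Cylinders and countable supports in Cantor cubes\<close>

abbreviation cantor_cube :: "'i set \<Rightarrow> ('i \<Rightarrow> nat) topology" where
  "cantor_cube I \<equiv> product_topology (\<lambda>_. discrete_topology {0,1}) I"

definition cylinder :: "'i set \<Rightarrow> 'i set \<Rightarrow> ('i \<Rightarrow> nat) \<Rightarrow> ('i \<Rightarrow> nat) set" where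
  "cylinder I a z = {y \<in> topspace (cantor_cube I). \<forall>i\<in>a. y i = z i}"

lemma compact_cantor_cube: "compact_space (cantor_cube I)"
  by (simp add: compact_space_product_topology compact_space_discrete_topology)

lemma openin_cantor_cube_cylinder:
  assumes "openin (cantor_cube I) G" "x \<in> G"
  shows "\<exists>a. finite a \<and> a \<subseteq> I \<and> cylinder I a x \<subseteq> G"
proof -
  obtain U where U: "finite {i \<in> I. U i \<noteq> {0,1}}" "x \<in> Pi\<^sub>E I U" "Pi\<^sub>E I U \<subseteq> G"
    using assms unfolding openin_product_topology_alt by auto
  have "cylinder I {i \<in> I. U i \<noteq> {0,1}} x \<subseteq> Pi\<^sub>E I U"
  proof
    fix y assume y: "y \<in> cylinder I {i \<in> I. U i \<noteq> {0,1}} x"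
    then have "y \<in> Pi\<^sub>E I (\<lambda>_. {0,1})" by (simp add: cylinder_def)
    moreover have "y i \<in> U i" if "i \<in> I" for i
    proof (cases "U i = {0,1}")
      case True then show ?thesis using \<open>y \<in> Pi\<^sub>E I (\<lambda>_. {0,1})\<close> that by auto
    next
      case False
      then have "y i = x i" using y that by (simp add: cylinder_def)
      then show ?thesis using U(2) that by auto
    qed
    ultimately show "y \<in> Pi\<^sub>E I U" by (auto simp: PiE_iff)
  qed
  then show ?thesis using U by (intro exI[of _ "{i \<in> I. U i \<noteq> {0,1}}"]) auto
qed

lemma openin_cylinder:
  assumes "finite a"
  shows "openin (cantor_cube I) (cylinder I a z)"
  unfolding openin_product_topology_alt
proof
  fix x assume x: "x \<in> cylinder I a z"
  define U where "U i = (if i \<in> a then {x i} else {0,1})" for i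
  have "x \<in> Pi\<^sub>E I (\<lambda>_. {0,1})" using x by (simp add: cylinder_def)
  moreover have "Pi\<^sub>E I U \<subseteq> cylinder I a z"
  proof
    fix y assume y: "y \<in> Pi\<^sub>E I U"
    \<comment> \<open>\<open>a\<close> may contain indices outside \<open>I\<close>; there all
      points of the cube take the value \<open>undefined\<close>.\<close>
    have "y i = x i" if "i \<in> a" for i
      using PiE_mem[OF y, of i] PiE_arb[OF y, of i] PiE_arb[OF \<open>x \<in> Pi\<^sub>E I (\<lambda>_. {0,1})\<close>, of i] that
      by (cases "i \<in> I") (simp_all add: U_def)
    moreover have "y i \<in> {0,1}" if "i \<in> I" for i
    proof -
      have "U i \<subseteq> {0,1}" using PiE_mem[OF \<open>x \<in> Pi\<^sub>E I (\<lambda>_. {0,1})\<close> that] by (auto simp: U_def)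
      then show ?thesis using PiE_mem[OF y that] by blast
    qed
    then have "y \<in> Pi\<^sub>E I (\<lambda>_. {0,1})" using y by (auto simp: PiE_iff)
    ultimately show "y \<in> cylinder I a z" using x by (simp add: cylinder_def)
  qed
  moreover have "finite {i \<in> I. U i \<noteq> {0,1}}"
    by (rule finite_subset[OF _ assms]) (auto simp: U_def)
  ultimately show "\<exists>U. finite {i \<in> I. U i \<noteq> topspace (discrete_topology {0,1})} \<and>
      (\<forall>i\<in>I. openin (discrete_topology {0,1}) (U i)) \<and> x \<in> Pi\<^sub>E I U \<and> Pi\<^sub>E I U \<subseteq> cylinder I a z"
    by (intro exI[of _ U]) (auto simp: U_def PiE_iff)
qed

lemma cylinder_cover:
  assumes T: "compactin (cantor_cube I) T" and a: "\<And>t. t \<in> T \<Longrightarrow> finite (a t)"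
  obtains T0 where "finite T0" "T0 \<subseteq> T" "T \<subseteq> (\<Union>t\<in>T0. cylinder I (a t) t)"
proof -
  have "T \<subseteq> topspace (cantor_cube I)" using compactin_subset_topspace[OF T] .
  then have "T \<subseteq> \<Union>((\<lambda>t. cylinder I (a t) t) ` T)" unfolding cylinder_def by auto
  moreover have "Ball ((\<lambda>t. cylinder I (a t) t) ` T) (openin (cantor_cube I))" using openin_cylinder a by blast
  ultimately obtain \<F> where \<F>: "finite \<F>" "\<F> \<subseteq> (\<lambda>t. cylinder I (a t) t) ` T" "T \<subseteq> \<Union>\<F>"
    using T unfolding compactin_def by meson
  then obtain T0 where "T0 \<subseteq> T" "finite T0" "\<F> = (\<lambda>t. cylinder I (a t) t) ` T0"
    by (meson finite_subset_image)
  then show thesis using that \<F>(3) by blast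
qed

text \<open>By compactness of the \<open>K n\<close>, \<open>G\<close> is a union of countably many
  cylinders with finitely many coordinates each. Together these coordinates decide membership in
  \<open>G\<close>.\<close>

lemma countable_support:
  assumes G: "openin (cantor_cube I) G" "G = (\<Union>n::nat. K n)" and K: "\<And>n. compactin (cantor_cube I) (K n)"
  shows "\<exists>s. countable s \<and> (\<forall>x\<in>G. \<forall>y\<in>topspace (cantor_cube I). (\<forall>i\<in>s. y i = x i) \<longrightarrow> y \<in> G)"
proof -
  obtain a where a: "\<And>x. x \<in> G \<Longrightarrow> finite (a x)" "\<And>x. x \<in> G \<Longrightarrow> cylinder I (a x) x \<subseteq> G"
    using openin_cantor_cube_cylinder[OF G(1)] by metis
  have "\<exists>T0. finite T0 \<and> T0 \<subseteq> K n \<and> K n \<subseteq> (\<Union>t\<in>T0. cylinder I (a t) t)" for n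
  proof -
    have "finite (a t)" if "t \<in> K n" for t using a(1) G(2) that by blast
    then show ?thesis using cylinder_cover[OF K, of n a] by metis
  qed
  then obtain T0 where T0: "\<And>n. finite (T0 n)" "\<And>n. T0 n \<subseteq> K n" "\<And>n. K n \<subseteq> (\<Union>t\<in>T0 n. cylinder I (a t) t)"
    by metis
  define s where "s = (\<Union>n. \<Union>t\<in>T0 n. a t)"
  have T0G: "t \<in> G" if "t \<in> T0 n" for t n using T0(2) G(2) that by blast
  have "countable s"
    unfolding s_def using T0(1) a(1) T0G by (intro countable_UN) (auto intro: countable_finite)
  moreover have "y \<in> G" if x: "x \<in> G" and y: "y \<in> topspace (cantor_cube I)" "\<forall>i\<in>s. y i = x i" for x y
  proof -
    obtain n t where t: "t \<in> T0 n" "x \<in> cylinder I (a t) t" using x T0(3) G(2) by blast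
    then have "a t \<subseteq> s" by (auto simp: s_def)
    then have "y \<in> cylinder I (a t) t" using t(2) y unfolding cylinder_def by auto
    then show ?thesis using a(2) T0G t(1) by blast
  qed
  ultimately show ?thesis by blast
qed

lemma countable_cylinders:
  assumes "countable J"
  shows "countable {cylinder I a z | a z. finite a \<and> a \<subseteq> J \<and> z \<in> topspace (cantor_cube I)}" (is "countable ?B")
proof -
  \<comment> \<open>A cylinder depends only on the values of its centre on \<open>a\<close>, and
    \<open>h\<close> rebuilds these from the set of indices in \<open>a\<close> with value
    1.\<close>
  define h :: "'a set \<Rightarrow> 'a \<Rightarrow> nat" where "h u i = (if i \<in> u then 1 else if i \<in> I then 0 else undefined)" for u i
  have "?B \<subseteq> (\<Union>a\<in>{a. finite a \<and> a \<subseteq> J}. (\<lambda>u. cylinder I a (h u)) ` Pow a)"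
  proof
    fix c assume "c \<in> ?B"
    then obtain a z where a: "finite a" "a \<subseteq> J" "c = cylinder I a z" and z: "z \<in> topspace (cantor_cube I)" by blast
    have "z i = h {i\<in>a. z i = 1} i" if "i \<in> a" for i
      using that z by (auto simp: h_def PiE_iff extensional_def)
    then have "c = cylinder I a (h {i\<in>a. z i = 1})" unfolding a(3) cylinder_def by auto
    then show "c \<in> (\<Union>a\<in>{a. finite a \<and> a \<subseteq> J}. (\<lambda>u. cylinder I a (h u)) ` Pow a)"
      using a by (intro UN_I[of a] image_eqI[of _ _ "{i\<in>a. z i = 1}"]) auto
  qed
  moreover have "countable (\<Union>a\<in>{a. finite a \<and> a \<subseteq> J}. (\<lambda>u. cylinder I a (h u)) ` Pow a)"
    using assms by (intro countable_UN countable_Collect_finite_subset countable_image) (auto intro: countable_finite)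
  ultimately show ?thesis by (rule countable_subset)
qed

section \<open>Reflection of supersets\<close>

text \<open>Let \<open>J\<close> collect the supports of the members of \<open>N\<close>. Cover part
  of the preimage of \<open>U\<close> by finitely many cylinders and forget their coordinates
  outside \<open>J\<close>. The image of the enlarged cylinders still lies in every \<open>W\<close>
  in \<open>N\<close> above \<open>U\<close>, since the preimage of \<open>W\<close> ignores the
  forgotten coordinates. It also contains a member of \<open>A\<close> that \<open>\<Phi>\<close>
  chooses from finitely many cylinders over \<open>J\<close>, hence one in \<open>N\<close>.\<close>

lemma superset_reflection:
  assumes f: "continuous_map (cantor_cube I) X f" "f ` topspace (cantor_cube I) = topspace X"
    and X: "compact_space X" "Hausdorff_space X" and A: "is_base X A" "{} \<notin> A"
    and sc: "\<And>U. U \<in> A \<Longrightarrow> \<exists>K::nat \<Rightarrow> 'a set. (\<forall>n. compactin X (K n)) \<and> U = (\<Union>n. K n)"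
  obtains \<Phi> where "\<And>F. finite F \<Longrightarrow> F \<subseteq> A \<Longrightarrow> countable (\<Phi> F) \<and> \<Phi> F \<subseteq> A"
    "\<And>N U. N \<subseteq> A \<Longrightarrow> closed_under \<Phi> N \<Longrightarrow> U \<in> A \<Longrightarrow> \<exists>U'\<in>N. \<forall>W\<in>N. U \<subseteq> W \<longrightarrow> U' \<subseteq> W"
proof -
  let ?T = "topspace (cantor_cube I)"
  define pre where "pre U = {x \<in> ?T. f x \<in> U}" for U
  have A_open: "openin X U" if "U \<in> A" for U using A(1) that by (simp add: is_base_def)
  have pre_compact: "compactin (cantor_cube I) (pre C)" if "closedin X C" for C
    unfolding pre_def using closedin_continuous_map_preimage[OF f(1) that] compact_cantor_cube
    by (rule closedin_compact_space[rotated])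
  have "\<exists>s. countable s \<and> (\<forall>x\<in>pre U. \<forall>y\<in>?T. (\<forall>i\<in>s. y i = x i) \<longrightarrow> y \<in> pre U)" if U: "U \<in> A" for U
  proof -
    obtain K :: "nat \<Rightarrow> 'a set" where K: "\<And>n. compactin X (K n)" "U = (\<Union>n. K n)" using sc[OF U] by metis
    have "openin (cantor_cube I) (pre U)"
      unfolding pre_def using openin_continuous_map_preimage[OF f(1) A_open[OF U]] .
    moreover have "pre U = (\<Union>n. pre (K n))" unfolding K(2) pre_def by blast
    moreover have "compactin (cantor_cube I) (pre (K n))" for n
      using pre_compact compactin_imp_closedin[OF X(2) K(1)] by blast
    ultimately show ?thesis by (rule countable_support)
  qed
  then obtain supp where supp: "\<And>U. U \<in> A \<Longrightarrow> countable (supp U)"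
      "\<And>U x y. U \<in> A \<Longrightarrow> x \<in> pre U \<Longrightarrow> y \<in> ?T \<Longrightarrow> (\<forall>i\<in>supp U. y i = x i) \<Longrightarrow> y \<in> pre U"
    by metis
  define cylinders where "cylinders J = {cylinder I a z | a z. finite a \<and> a \<subseteq> J \<and> z \<in> ?T}" for J
  define pick where "pick C = (SOME U. U \<in> A \<and> U \<subseteq> f ` C)" for C
  define \<Phi> where "\<Phi> F = (\<lambda>\<C>. pick (\<Union>\<C>)) ` {\<C>. (finite \<C> \<and> \<C> \<subseteq> cylinders (\<Union>(supp ` F))) \<and> (\<exists>U\<in>A. U \<subseteq> f ` \<Union>\<C>)}" for F
  have pick: "pick C \<in> A" "pick C \<subseteq> f ` C" if "\<exists>U\<in>A. U \<subseteq> f ` C" for C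
    using someI_ex[of "\<lambda>U. U \<in> A \<and> U \<subseteq> f ` C"] that unfolding pick_def by blast+
  have 1: "countable (\<Phi> F) \<and> \<Phi> F \<subseteq> A" if "finite F" "F \<subseteq> A" for F
  proof
    have "countable (\<Union>(supp ` F))" using that supp(1) countable_finite[OF that(1)] by auto
    then have "countable {\<C>. finite \<C> \<and> \<C> \<subseteq> cylinders (\<Union>(supp ` F))}"
      unfolding cylinders_def by (intro countable_Collect_finite_subset countable_cylinders)
    then show "countable (\<Phi> F)"
      unfolding \<Phi>_def by (intro countable_image, elim countable_subset[rotated]) blast
    show "\<Phi> F \<subseteq> A" unfolding \<Phi>_def using pick(1) by blast
  qed
  have 2: "\<exists>U'\<in>N. \<forall>W\<in>N. U \<subseteq> W \<longrightarrow> U' \<subseteq> W" if N: "N \<subseteq> A" "closed_under \<Phi> N" and U: "U \<in> A" for N U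
  proof -
    define J where "J = \<Union>(supp ` N)"
    obtain q where "q \<in> U" using U A(2) by (metis all_not_in_conv)
    then obtain P C where P: "openin X P" "closedin X C" "q \<in> P" "P \<subseteq> C" "C \<subseteq> U"
      using compact_Hausdorff_imp_regular_space[OF X] A_open[OF U]
      unfolding neighbourhood_base_of_closedin[symmetric] neighbourhood_base_of by metis
    have "openin (cantor_cube I) (pre U)"
      unfolding pre_def using openin_continuous_map_preimage[OF f(1) A_open[OF U]] .
    then obtain a where a: "\<And>t. t \<in> pre U \<Longrightarrow> finite (a t)" "\<And>t. t \<in> pre U \<Longrightarrow> cylinder I (a t) t \<subseteq> pre U"
      using openin_cantor_cube_cylinder by metis
    have CU: "pre C \<subseteq> pre U" using P(5) by (auto simp: pre_def)
    have fin: "finite (a t \<inter> J)" if "t \<in> pre C" for t using a(1) CU that by blast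
    \<comment> \<open>Dropping coordinates only enlarges the cylinders, so those around points of
      \<open>pre C\<close> cover it.\<close>
    obtain T0 where T0: "finite T0" "T0 \<subseteq> pre C" "pre C \<subseteq> (\<Union>t\<in>T0. cylinder I (a t \<inter> J) t)"
      by (rule cylinder_cover[OF pre_compact[OF P(2)] fin])
    define \<C> where "\<C> = (\<lambda>t. cylinder I (a t \<inter> J) t) ` T0"
    define b where "b = (\<Union>t\<in>T0. a t \<inter> J)"
    have finb: "finite b" unfolding b_def using T0 a(1) CU by blast
    \<comment> \<open>The finitely many coordinates in \<open>b\<close> are supported by finitely
      many members \<open>v i\<close> of \<open>N\<close>, to which closedness applies.\<close>
    have "\<forall>i\<in>b. \<exists>V\<in>N. i \<in> supp V" by (auto simp: b_def J_def)
    then obtain v where v: "\<And>i. i \<in> b \<Longrightarrow> v i \<in> N \<and> i \<in> supp (v i)" by metis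
    have "\<C> \<subseteq> cylinders (\<Union>(supp ` v ` b))"
    proof
      fix c assume "c \<in> \<C>"
      then obtain t where t: "t \<in> T0" "c = cylinder I (a t \<inter> J) t" by (auto simp: \<C>_def)
      then have "a t \<inter> J \<subseteq> b" by (auto simp: b_def)
      then have "a t \<inter> J \<subseteq> \<Union>(supp ` v ` b)" using v by blast
      moreover have "t \<in> pre U" using t(1) T0(2) CU by blast
      then have "finite (a t \<inter> J)" "t \<in> ?T" using a(1) by (auto simp: pre_def)
      ultimately show "c \<in> cylinders (\<Union>(supp ` v ` b))" unfolding cylinders_def t(2) by blast
    qed
    moreover have "\<exists>V\<in>A. V \<subseteq> f ` \<Union>\<C>"
    proof -
      have "P \<subseteq> f ` \<Union>\<C>"
      proof
        fix p assume "p \<in> P"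
        then have "p \<in> f ` ?T" using f(2) openin_subset[OF P(1)] by blast
        then obtain x where "x \<in> ?T" "p = f x" by blast
        then have "x \<in> pre C" using \<open>p \<in> P\<close> P(4) by (auto simp: pre_def)
        then show "p \<in> f ` \<Union>\<C>" using T0(3) \<open>p = f x\<close> unfolding \<C>_def by blast
      qed
      moreover have "\<exists>V\<in>A. q \<in> V \<and> V \<subseteq> P" using A(1) P(1,3) by (simp add: is_base_def)
      ultimately show ?thesis by (meson subset_trans)
    qed
    ultimately have "pick (\<Union>\<C>) \<in> \<Phi> (v ` b)" "pick (\<Union>\<C>) \<subseteq> f ` \<Union>\<C>"
      using T0(1) pick(2) by (auto simp: \<Phi>_def \<C>_def)
    moreover have "\<Phi> (v ` b) \<subseteq> N" using closed_underD[OF N(2)] finb v by blast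
    moreover have "f ` \<Union>\<C> \<subseteq> W" if W: "W \<in> N" "U \<subseteq> W" for W
    proof
      fix p assume "p \<in> f ` \<Union>\<C>"
      then obtain t x where t: "t \<in> T0" and x: "x \<in> cylinder I (a t \<inter> J) t" "p = f x"
        by (auto simp: \<C>_def)
      have tU: "t \<in> pre U" using t T0(2) CU by blast
      \<comment> \<open>\<open>y\<close> follows \<open>x\<close> on \<open>J\<close> and
        \<open>t\<close> elsewhere. It agrees with \<open>t\<close> on all of \<open>a t\<close>, so
        it lies over \<open>U\<close> and hence over \<open>W\<close>; it agrees with
        \<open>x\<close> on \<open>supp W\<close>, so \<open>x\<close> lies over \<open>W\<close>
        too.\<close>
      define y where "y i = (if i \<in> J then x i else t i)" for i
      have xt: "x \<in> ?T" "t \<in> ?T" using x(1) tU by (auto simp: cylinder_def pre_def)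
      then have "y \<in> ?T" by (auto simp: y_def PiE_iff extensional_def)
      then have "y \<in> cylinder I (a t) t" using x(1) by (auto simp: cylinder_def y_def)
      then have "y \<in> pre U" using a(2)[OF tU] by blast
      then have yW: "y \<in> pre W" using W(2) by (auto simp: pre_def)
      have "\<forall>i\<in>supp W. x i = y i" using W(1) by (auto simp: y_def J_def)
      then have "x \<in> pre W" using supp(2)[OF _ yW xt(1)] W(1) N(1) by blast
      then show "p \<in> W" by (simp add: pre_def x(2))
    qed
    ultimately show ?thesis by (meson subset_iff)
  qed
  show thesis using 1 2 by (rule that)
qed

section \<open>Assembling the theorem\<close>

theorem theorem3p36:
  fixes X :: "'a topology"
  assumes "dyadic_compactum TYPE('i) X"
  shows "(\<forall>\<A>. (\<forall>U\<in>\<A>. cozero_set X U) \<and> is_base X \<A> \<and> Nt_le X omega1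
            \<longrightarrow> (\<exists>\<B>\<subseteq>\<A>. is_base X \<B> \<and> op_like natLeq \<B>))
         \<and> \<not> Nt_eq X omega1"
proof -
  obtain I :: "'i set" and f where f: "continuous_map (cantor_cube I) X f"
      "f ` topspace (cantor_cube I) = topspace X" and Hausdorff: "Hausdorff_space X"
    using assms by (auto simp: dyadic_compactum_def)
  have compact: "compact_space X"
    using image_compactin[OF _ f(1)] compact_cantor_cube f(2) by (metis compact_space_def)
  have subbase: "\<exists>\<B>\<subseteq>\<A>. is_base X \<B> \<and> op_like natLeq \<B>"
    if \<A>: "\<forall>U\<in>\<A>. cozero_set X U" "is_base X \<A>" and Nt: "Nt_le X omega1" for \<A>
  proof -
    \<comment> \<open>Reflection concerns nonempty sets, and a base remains one without the empty
      set.\<close>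
    define A where "A = \<A> - {{}}"
    have A: "is_base X A" "{} \<notin> A"
      using \<A>(2) unfolding is_base_def A_def by (auto 4 4)
    have sc: "\<exists>K::nat \<Rightarrow> 'a set. (\<forall>n. compactin X (K n)) \<and> U = (\<Union>n. K n)" if "U \<in> A" for U
      using cozero_set_sigma_compact[OF compact] \<A>(1) that by (auto simp: A_def)
    obtain Q where Q: "is_base X Q" "\<And>V. openin X V \<Longrightarrow> V \<noteq> {} \<Longrightarrow> countable {W\<in>Q. V \<subseteq> W}"
      using Nt_le_omega1_imp_countable_supersets[OF Nt] by blast
    obtain \<Phi>0 where \<Phi>0: "\<And>F. finite F \<Longrightarrow> F \<subseteq> A \<Longrightarrow> countable (\<Phi>0 F) \<and> \<Phi>0 F \<subseteq> A"
      "\<And>N q P. N \<subseteq> A \<Longrightarrow> closed_under \<Phi>0 N \<Longrightarrow> (\<And>P. openin X P \<Longrightarrow> q \<in> P \<Longrightarrow> \<exists>V\<in>N. V \<subseteq> P) \<Longrightarrow>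
          openin X P \<Longrightarrow> q \<in> P \<Longrightarrow> \<exists>V\<in>N. q \<in> V \<and> V \<subseteq> P"
      by (rule local_base_reflection[OF compact Hausdorff A Q]) auto
    obtain \<Phi>1 where \<Phi>1: "\<And>F. finite F \<Longrightarrow> F \<subseteq> A \<Longrightarrow> countable (\<Phi>1 F) \<and> \<Phi>1 F \<subseteq> A"
      "\<And>N U. N \<subseteq> A \<Longrightarrow> closed_under \<Phi>1 N \<Longrightarrow> U \<in> A \<Longrightarrow> \<exists>U'\<in>N. \<forall>W\<in>N. U \<subseteq> W \<longrightarrow> U' \<subseteq> W"
      by (rule superset_reflection[OF f compact Hausdorff A sc]) auto
    interpret reflecting_base X A "\<lambda>F. \<Phi>0 F \<union> \<Phi>1 F"
    proof
      show "\<exists>V\<in>N. q \<in> V \<and> V \<subseteq> P"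
        if "N \<subseteq> A" "closed_under (\<lambda>F. \<Phi>0 F \<union> \<Phi>1 F) N"
          "\<And>P. openin X P \<Longrightarrow> q \<in> P \<Longrightarrow> \<exists>V\<in>N. V \<subseteq> P" "openin X P" "q \<in> P" for N q P
        using \<Phi>0(2)[OF that(1) _ that(3-5)] that(2) by (simp add: closed_under_Un_iff)
      show "\<exists>U'\<in>N. \<forall>W\<in>N. U \<subseteq> W \<longrightarrow> U' \<subseteq> W"
        if "N \<subseteq> A" "closed_under (\<lambda>F. \<Phi>0 F \<union> \<Phi>1 F) N" "U \<in> A" for N U
        using \<Phi>1(2)[OF that(1) _ that(3)] that(2) by (simp add: closed_under_Un_iff)
      show "countable (\<Phi>0 F \<union> \<Phi>1 F) \<and> \<Phi>0 F \<union> \<Phi>1 F \<subseteq> A" if "finite F" "F \<subseteq> A" for F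
        using \<Phi>0(1)[OF that] \<Phi>1(1)[OF that] by simp
    qed (use compact Hausdorff A sc in auto)
    obtain B where "B \<subseteq> A" "is_base X B" "op_like natLeq B"
      using noetherian_subbase by blast
    moreover have "A \<subseteq> \<A>" by (auto simp: A_def)
    ultimately show ?thesis by (meson subset_trans)
  qed
  moreover have "\<not> Nt_eq X omega1"
  proof
    assume Nt: "Nt_eq X omega1"
    then obtain B where B: "is_base X B" "op_like natLeq B"
      using subbase[OF _ is_base_cozero_sets[OF compact Hausdorff]] by (auto simp: Nt_eq_def)
    \<comment> \<open>\<open>Nt_lt\<close> asks for a cardinal of the same type as
      \<open>omega1\<close>, so the countable cardinal is realised on the singletons in
      \<open>nat set\<close>.\<close>
    define \<nu> :: "nat set rel" where "\<nu> = |range (\<lambda>n::nat. {n})|"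
    have "|UNIV::nat set| =o \<nu>"
      unfolding \<nu>_def by (rule card_of_ordIsoI[of "\<lambda>n. {n}"]) (simp add: bij_betw_def inj_on_def)
    then have \<nu>: "natLeq =o \<nu>"
      using card_of_nat ordIso_symmetric ordIso_transitive by blast
    have "\<nu> <o omega1"
      using ordIso_symmetric[OF \<nu>] cardSuc_greater[OF natLeq_Card_order] by (rule ordIso_ordLess_trans)
    moreover have "op_like \<nu> B"
      unfolding op_like_def
    proof
      fix U assume "U \<in> B"
      then have "|{C \<in> B. U \<subseteq> C}| <o natLeq" using B(2) by (simp add: op_like_def)
      then show "|{C \<in> B. U \<subseteq> C}| <o \<nu>" using \<nu> by (rule ordLess_ordIso_trans)
    qed
    moreover have "Card_order \<nu>" "natLeq \<le>o \<nu>"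
      using \<nu> by (simp_all add: \<nu>_def card_of_Card_order ordIso_imp_ordLeq)
    ultimately have "Nt_lt X omega1" using B(1) unfolding Nt_lt_def by blast
    then show False using Nt by (simp add: Nt_eq_def)
  qed
  ultimately show ?thesis by blast
qed

end
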